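(* Let $n\ge 1$ be an integer and $\alpha\in\mathbb{R}$. Let $J_n(\alpha)\in\mathbb{R}^{n\times n}$ be the Jordan block with diagonal entries $\alpha$, superdiagonal entries $1$, and all other entries $0$. Then: (i) $J_n(\alpha)$ is dissipative if and only if $\alpha\le -\cos\frac{\pi}{n+1}$. (ii) $-J_n(\alpha)$ is dissipative if and only if $\alpha\ge \cos\frac{\pi}{n+1}$.
   Context: A matrix $A\in\mathbb{R}^{n\times n}$ is called dissipative if $\langle Aa,a\rangle\le 0$ for all $a\in\mathbb{R}^n$, where $\langle\cdot,\cdot\rangle$ is the standard Euclidean inner product ($A$ is not assumed symmetric). *)

theory Defs
  imports Complex_Main "Jordan_Normal_Form.Jordan_Normal_Form"
begin

definition dissipative :: "real mat \<Rightarrow> bool" where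
  "dissipative A \<longleftrightarrow>
     square_mat A \<and> (\<forall>a \<in> carrier_vec (dim_row A). (A *\<^sub>v a) \<bullet> a \<le> 0)"

end

theory Submission
  imports Defs
begin

text \<open>
  The quadratic form of \<open>J\<^sub>n(\<alpha>)\<close> is \<open>\<alpha> \<Sum> a\<^sub>i\<^sup>2 + \<Sum> a\<^sub>i a\<^sub>i\<^sub>+\<^sub>1\<close>. With \<open>\<theta> = \<pi>/(n+1)\<close>, the positive numbers
  \<open>s\<^sub>k = sin (k \<theta>)\<close> for \<open>1 \<le> k \<le> n\<close> satisfy \<open>s\<^sub>k\<^sub>-\<^sub>1 + s\<^sub>k\<^sub>+\<^sub>1 = 2 cos \<theta> s\<^sub>k\<close> and \<open>s\<^sub>0 = s\<^sub>n\<^sub>+\<^sub>1 = 0\<close>, so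
  AM-GM with weights \<open>s\<^sub>k\<^sub>+\<^sub>1/s\<^sub>k\<close> gives \<open>\<Sum> a\<^sub>i a\<^sub>i\<^sub>+\<^sub>1 \<le> cos \<theta> \<Sum> a\<^sub>i\<^sup>2\<close>, with equality for \<open>a = s\<close>.
  The sign change \<open>a\<^sub>i \<mapsto> (-1)\<^sup>i a\<^sub>i\<close> flips the mixed sum and turns (i) into (ii).
\<close>

lemma sin_mult_recurrence:
  fixes \<theta> :: real
  shows "sin (real (Suc (Suc k)) * \<theta>) = 2 * cos \<theta> * sin (real (Suc k) * \<theta>) - sin (real k * \<theta>)"
proof -
  have "real (Suc (Suc k)) * \<theta> = real (Suc k) * \<theta> + \<theta>" "real k * \<theta> = real (Suc k) * \<theta> - \<theta>"
    by (simp_all add: algebra_simps)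
  then show ?thesis
    by (simp only: sin_add sin_diff) (simp add: algebra_simps)
qed

lemma sin_mult_pos:
  assumes "0 < k" "k \<le> n"
  shows "sin (real k * (pi / (real n + 1))) > 0"
proof (rule sin_gt_zero)
  have "real k < real n + 1"
    using assms by linarith
  then have "pi * (real k / (real n + 1)) < pi * 1"
    by (intro mult_strict_left_mono) auto
  then show "real k * (pi / (real n + 1)) < pi"
    by (simp add: mult.commute)
qed (use assms in simp)

lemma weighted_am_gm:
  fixes x y p q :: real
  assumes "p > 0" "q > 0"
  shows "2 * x * y \<le> q / p * x\<^sup>2 + p / q * y\<^sup>2"
proof -
  have "q / p * x\<^sup>2 + p / q * y\<^sup>2 - 2 * x * y = (q * x - p * y)\<^sup>2 / (p * q)"
    using assms by (simp add: field_simps power2_eq_square)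
  also have "\<dots> \<ge> 0"
    using assms by simp
  finally show ?thesis by simp
qed

text \<open>Write \<open>s k\<close> for \<open>sin (k * \<theta>)\<close>. The last term is the
  part of the bound on \<open>x m\<close> left over from AM-GM. In the induction step the next
  product adds \<open>s (m+2) / (2 * s (m+1))\<close> to the coefficient of
  \<open>(x m)\<^sup>2\<close>, and by the recurrence both together are exactly
  \<open>cos \<theta>\<close>. The bound \<open>m < n\<close> keeps the denominator
  positive.\<close>

lemma sum_consecutive_partial:
  fixes x :: "nat \<Rightarrow> real" and n :: nat
  defines "\<theta> \<equiv> pi / (real n + 1)"
  assumes "m < n"
  shows "(\<Sum>i<m. x i * x (Suc i))
    \<le> cos \<theta> * (\<Sum>i<m. (x i)\<^sup>2) + sin (real m * \<theta>) / (2 * sin (real (Suc m) * \<theta>)) * (x m)\<^sup>2"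
  using assms(2)
proof (induction m)
  case 0
  show ?case by simp
next
  case (Suc m)
  let ?s = "\<lambda>k. sin (real k * \<theta>)"
  have pos: "?s (Suc m) > 0" "?s (Suc (Suc m)) > 0"
    using Suc.prems by (auto simp only: \<theta>_def intro!: sin_mult_pos)
  have "?s m / (2 * ?s (Suc m)) = cos \<theta> - ?s (Suc (Suc m)) / ?s (Suc m) / 2"
    using pos(1) sin_mult_recurrence[of m \<theta>] by (simp add: field_simps del: of_nat_Suc)
  then have "(\<Sum>i<m. x i * x (Suc i))
      \<le> cos \<theta> * (\<Sum>i<m. (x i)\<^sup>2) + (cos \<theta> - ?s (Suc (Suc m)) / ?s (Suc m) / 2) * (x m)\<^sup>2"
    using Suc.IH Suc.prems by simp
  moreover have "2 * x m * x (Suc m)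
      \<le> ?s (Suc (Suc m)) / ?s (Suc m) * (x m)\<^sup>2 + ?s (Suc m) / ?s (Suc (Suc m)) * (x (Suc m))\<^sup>2"
    using weighted_am_gm[OF pos] .
  ultimately show ?case
    by (simp add: algebra_simps del: of_nat_Suc)
qed

lemma sin_mult_Suc_Suc_eq_0: "sin (real (Suc (Suc N)) * (pi / (real (Suc N) + 1))) = 0"
proof -
  have "real (Suc (Suc N)) * (pi / (real (Suc N) + 1)) = pi"
    by (simp add: field_simps)
  then show ?thesis by (simp only: sin_pi)
qed

text \<open>At the last index \<open>s (N+2) = 0\<close>, so the recurrence turns the leftover
  coefficient into \<open>cos \<theta>\<close>, which supplies the missing final square.\<close>

lemma sum_consecutive_le:
  fixes x :: "nat \<Rightarrow> real"
  shows "(\<Sum>i<N. x i * x (Suc i)) \<le> cos (pi / (real (Suc N) + 1)) * (\<Sum>i<Suc N. (x i)\<^sup>2)"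
proof -
  let ?\<theta> = "pi / (real (Suc N) + 1)"
  have "sin (real (Suc N) * ?\<theta>) > 0"
    by (rule sin_mult_pos) auto
  then have "sin (real N * ?\<theta>) / (2 * sin (real (Suc N) * ?\<theta>)) = cos ?\<theta>"
    using sin_mult_recurrence[of N ?\<theta>] sin_mult_Suc_Suc_eq_0[of N]
    by (simp add: nonzero_divide_eq_eq del: of_nat_Suc)
  moreover note sum_consecutive_partial[of N "Suc N" x]
  ultimately show ?thesis
    by (simp only: lessI sum.lessThan_Suc distrib_left)
qed

text \<open>With \<open>p m = s m * s (m+1)\<close>, the recurrence gives
  \<open>p (m+1) + p m = 2 * cos \<theta> * (s (m+1))\<^sup>2\<close>; solving for
  \<open>p (m+1)\<close> leaves half a telescoping difference.\<close>

lemma sum_consecutive_sin: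
  fixes \<theta> :: real
  shows "(\<Sum>i<m. sin (real (Suc i) * \<theta>) * sin (real (Suc (Suc i)) * \<theta>))
    = cos \<theta> * (\<Sum>i<m. (sin (real (Suc i) * \<theta>))\<^sup>2) + sin (real m * \<theta>) * sin (real (Suc m) * \<theta>) / 2"
proof (induction m)
  case (Suc m)
  let ?s = "\<lambda>k. sin (real k * \<theta>)"
  have "?s (Suc m) * ?s (Suc (Suc m)) = ?s (Suc m) * (2 * cos \<theta> * ?s (Suc m) - ?s m)"
    by (simp only: sin_mult_recurrence)
  with Suc show ?case
    by (simp add: algebra_simps power2_eq_square del: of_nat_Suc)
qed simp

lemma obtain_extremal_vector:
  fixes N :: nat
  obtains x :: "nat \<Rightarrow> real"
  where "(\<Sum>i<N. x i * x (Suc i)) = cos (pi / (real (Suc N) + 1)) * (\<Sum>i<Suc N. (x i)\<^sup>2)"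
    and "(\<Sum>i<Suc N. (x i)\<^sup>2) > 0"
proof
  let ?\<theta> = "pi / (real (Suc N) + 1)"
  define x where "x = (\<lambda>i. sin (real (Suc i) * ?\<theta>))"
  \<comment> \<open>One summand more than needed: the boundary term then contains
    \<open>s (N+2) = 0\<close>, and the extra product vanishes for the same reason.\<close>
  have "(\<Sum>i<Suc N. x i * x (Suc i)) = cos ?\<theta> * (\<Sum>i<Suc N. (x i)\<^sup>2)"
    unfolding x_def sum_consecutive_sin sin_mult_Suc_Suc_eq_0 by simp
  moreover have "x (Suc N) = 0"
    unfolding x_def by (rule sin_mult_Suc_Suc_eq_0)
  ultimately show "(\<Sum>i<N. x i * x (Suc i)) = cos ?\<theta> * (\<Sum>i<Suc N. (x i)\<^sup>2)"
    by simp
  show "(\<Sum>i<Suc N. (x i)\<^sup>2) > 0"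
  proof (rule sum_pos)
    fix i assume "i \<in> {..<Suc N}"
    then have "x i > 0"
      unfolding x_def by (intro sin_mult_pos) auto
    then show "(x i)\<^sup>2 > 0" by simp
  qed auto
qed

lemma quadratic_form_nonpos_iff:
  fixes \<alpha> :: real
  shows "(\<forall>x :: nat \<Rightarrow> real. \<alpha> * (\<Sum>i<Suc N. (x i)\<^sup>2) + (\<Sum>i<N. x i * x (Suc i)) \<le> 0)
    \<longleftrightarrow> \<alpha> \<le> - cos (pi / (real (Suc N) + 1))"
    (is "(\<forall>x. ?Q x \<le> 0) \<longleftrightarrow> \<alpha> \<le> - ?c")
proof
  obtain x where extremal:
      "(\<Sum>i<N. x i * x (Suc i)) = ?c * (\<Sum>i<Suc N. (x i)\<^sup>2)" "(\<Sum>i<Suc N. (x i)\<^sup>2) > 0"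
    by (rule obtain_extremal_vector)
  assume "\<forall>x. ?Q x \<le> 0"
  \<comment> \<open>At the extremal vector the form is \<open>\<alpha> + ?c\<close> times a positive
    number.\<close>
  then have "(\<alpha> + ?c) * (\<Sum>i<Suc N. (x i)\<^sup>2) \<le> 0"
    by (simp only: distrib_right flip: extremal(1))
  with extremal(2) show "\<alpha> \<le> - ?c"
    by (simp only: mult_le_0_iff) linarith
next
  assume "\<alpha> \<le> - ?c"
  then have "\<alpha> * (\<Sum>i<Suc N. (x i)\<^sup>2) \<le> - ?c * (\<Sum>i<Suc N. (x i)\<^sup>2)" for x :: "nat \<Rightarrow> real"
    by (intro mult_right_mono sum_nonneg) auto
  then show "\<forall>x. ?Q x \<le> 0"
    using sum_consecutive_le[where N = N] by (smt (verit) mult_minus_left)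
qed

lemma jordan_block_quadratic_form:
  fixes \<alpha> :: real
  assumes "a \<in> carrier_vec (Suc N)"
  shows "(jordan_block (Suc N) \<alpha> *\<^sub>v a) \<bullet> a
    = \<alpha> * (\<Sum>i<Suc N. (a $ i)\<^sup>2) + (\<Sum>i<N. a $ i * a $ Suc i)"
proof -
  have row: "(jordan_block (Suc N) \<alpha> *\<^sub>v a) $ i = \<alpha> * a $ i + (if i < N then a $ Suc i else 0)"
    if "i < Suc N" for i
  proof -
    have "(jordan_block (Suc N) \<alpha> *\<^sub>v a) $ i
        = (\<Sum>j<Suc N. (if i = j then \<alpha> else if Suc i = j then 1 else 0) * a $ j)"
      using assms that by (auto simp: scalar_prod_def jordan_block_def lessThan_atLeast0 intro!: sum.cong)
    \<comment> \<open>Two delta sums; the second one has its support outside the range exactly when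
      \<open>i = N\<close>.\<close>
    also have "\<dots> = (\<Sum>j<Suc N. (if j = i then \<alpha> * a $ i else 0) + (if j = Suc i then a $ Suc i else 0))"
      by (rule sum.cong) auto
    finally show ?thesis
      using that by (simp only: sum.distrib sum.delta finite_lessThan lessThan_iff) simp
  qed
  have "(jordan_block (Suc N) \<alpha> *\<^sub>v a) \<bullet> a
      = (\<Sum>i<Suc N. (\<alpha> * a $ i + (if i < N then a $ Suc i else 0)) * a $ i)"
    using assms row by (simp only: scalar_prod_def lessThan_atLeast0) auto
  also have "\<dots> = \<alpha> * (\<Sum>i<Suc N. (a $ i)\<^sup>2) + (\<Sum>i<N. a $ i * a $ Suc i)"
    by (simp add: algebra_simps sum.distrib sum_distrib_left power2_eq_square)
  finally show ?thesis .
qed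

text \<open>Trades vectors for functions on all of \<open>nat\<close>; the assumption says that
  \<open>Q\<close> ignores the values at indices from \<open>n\<close> on.\<close>

lemma all_carrier_vec_iff:
  assumes "\<And>x. Q (($) (vec n x)) \<longleftrightarrow> Q x"
  shows "(\<forall>a \<in> carrier_vec n. Q (($) a)) \<longleftrightarrow> (\<forall>x. Q x)"
  using assms vec_carrier by blast

lemma dissipative_jordan_block_iff:
  "dissipative (jordan_block (Suc N) \<alpha>) \<longleftrightarrow>
    (\<forall>x. \<alpha> * (\<Sum>i<Suc N. (x i)\<^sup>2) + (\<Sum>i<N. x i * x (Suc i)) \<le> 0)"
    (is "_ \<longleftrightarrow> (\<forall>x. ?Q x \<le> 0)")
proof -
  have "(\<forall>a \<in> carrier_vec (Suc N). ?Q (($) a) \<le> 0) \<longleftrightarrow> (\<forall>x. ?Q x \<le> 0)"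
    by (rule all_carrier_vec_iff) simp
  then show ?thesis
    by (simp add: dissipative_def jordan_block_quadratic_form del: sum.lessThan_Suc)
qed

text \<open>Conjugation by the orthogonal matrix with diagonal entries \<open>(-1)^i\<close> takes
  the negated block to the block for \<open>- \<alpha>\<close>. The proof carries this out on
  quadratic forms.\<close>

lemma dissipative_uminus_jordan_block_iff:
  "dissipative (- jordan_block (Suc N) \<alpha>) \<longleftrightarrow> dissipative (jordan_block (Suc N) (- \<alpha>))"
proof -
  let ?S = "\<lambda>x :: nat \<Rightarrow> real. \<Sum>i<Suc N. (x i)\<^sup>2"
  let ?P = "\<lambda>x :: nat \<Rightarrow> real. \<Sum>i<N. x i * x (Suc i)"
  let ?alt = "\<lambda>(x :: nat \<Rightarrow> real) i. (-1) ^ i * x i"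
  have sign: "?S (?alt x) = ?S x" "?P (?alt x) = - ?P x" for x
  proof -
    show "?S (?alt x) = ?S x"
      by (rule sum.cong) (auto simp: power_mult_distrib simp flip: power_mult)
    have "?alt x i * ?alt x (Suc i) = - (x i * x (Suc i))" for i
      by (cases "even i") simp_all
    then show "?P (?alt x) = - ?P x"
      by (simp only: sum_negf)
  qed
  have invol: "(-1) ^ i * ((-1) ^ i * y) = y" for i and y :: real
    by (cases "even i") simp_all
  have "(- jordan_block (Suc N) \<alpha> *\<^sub>v a) \<bullet> a = - (\<alpha> * ?S (($) a) + ?P (($) a))"
    if "a \<in> carrier_vec (Suc N)" for a
    using that by (simp add: jordan_block_quadratic_form[symmetric] del: sum.lessThan_Suc)
  then have "dissipative (- jordan_block (Suc N) \<alpha>)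
      \<longleftrightarrow> (\<forall>a \<in> carrier_vec (Suc N). - (\<alpha> * ?S (($) a) + ?P (($) a)) \<le> 0)"
    by (simp add: dissipative_def del: sum.lessThan_Suc)
  also have "\<dots> \<longleftrightarrow> (\<forall>x. - (\<alpha> * ?S x + ?P x) \<le> 0)"
    by (rule all_carrier_vec_iff) simp
  \<comment> \<open>The sign change is an involution, hence \<open>?alt x\<close> ranges over all
    functions.\<close>
  also have "\<dots> \<longleftrightarrow> (\<forall>x. - (\<alpha> * ?S (?alt x) + ?P (?alt x)) \<le> 0)"
    (is "(\<forall>x. ?R x) \<longleftrightarrow> _")
  proof (intro iffI allI)
    fix x assume "\<forall>x. ?R (?alt x)"
    then have "?R (?alt (?alt x))" by (rule spec)
    then show "?R x" by (simp only: invol)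
  qed (erule spec)
  also have "\<dots> \<longleftrightarrow> dissipative (jordan_block (Suc N) (- \<alpha>))"
    unfolding sign dissipative_jordan_block_iff by (simp del: sum.lessThan_Suc)
  finally show ?thesis .
qed

theorem lemma2p2:
  fixes n :: nat and \<alpha> :: real
  assumes "n \<ge> 1"
  shows "(dissipative (jordan_block n \<alpha>) \<longleftrightarrow> \<alpha> \<le> - cos (pi / (real n + 1))) \<and>
         (dissipative (- jordan_block n \<alpha>) \<longleftrightarrow> \<alpha> \<ge> cos (pi / (real n + 1)))"
proof -
  obtain N where "n = Suc N"
    using assms by (cases n) auto
  then show ?thesis
    by (simp only: dissipative_uminus_jordan_block_iff dissipative_jordan_block_iff
        quadratic_form_nonpos_iff neg_le_iff_le)
qed

end
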